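(* Let $A$ be a race-free game and let $(\sigma,M_S)$ be a stopping strategy in $A$. Then $(\sigma,M_S)$ and its rigid image are both `may' equivalent and `must' equivalent.
   Context: **Event structures.** An event structure $(E,\leq,\mathrm{Con})$ is a set $E$ of events with a partial order $\leq$ (causal dependency) and a nonempty family $\mathrm{Con}$ of finite subsets of $E$ such that: $[e]=\{e'\mid e'\leq e\}$ is finite for all $e$; $\{e\}\in\mathrm{Con}$ for all $e$; $Y\subseteq X\in\mathrm{Con}$ implies $Y\in\mathrm{Con}$; $X\in\mathrm{Con}$ and $e\leq e'\in X$ imply $X\cup\{e\}\in\mathrm{Con}$. A configuration is a (possibly infinite) $x\subseteq E$ that is consistent (all finite subsets are in $\mathrm{Con}$) and down-closed. $\mathcal C^\infty(E)$ is the set of configurations, $\mathcal C(E)$ the set of finite ones. $e\prec e'$ means $e<e'$ with no event strictly between. A total map $f:E\to E'$ is a function sending each configuration to a configuration (by direct image) and injective on each configuration. **Polarity, games.** An event structure with polarity has a function $pol$ to $\{+,-,0\}$ ($+$ Player, $-$ Opponent, $0$ neutral); maps preserve polarity. A game is one with no neutral events. For configurations, $x\subseteq^- y$ means $x\subseteq y$ and all events of $y\setminus x$ have polarity $-$; $x\subseteq^+ y$ means $x\subseteq y$ and all events of $y\setminus x$ have polarity $+$ or $0$. A configuration is $+$-maximal if it is maximal in $\mathcal C^\infty$ w.r.t. $\subseteq^+$. A game is race-free if whenever $x\subseteq^+y$ and $x\subseteq^-z$ then $y\cup z$ is a configuration. $A^\perp$ is $A$ with $+,-$ swapped; $A\parallel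 B$ is the disjoint juxtaposition (no causal dependencies across; a finite set is consistent iff its components are); configurations are written $x_A\parallel x_B$. $\boxplus$ is the game with a single event, of polarity $+$. **Strategies.** A bare strategy from game $A$ to game $B$ is a total map $\sigma:S\to A^\perp\parallel N\parallel B$ of event structures with polarity, where $N$ has only neutral events, which is: receptive (for $x\in\mathcal C(S)$ and a finite configuration $y$ of the codomain, $\sigma x\subseteq^-y$ implies there is a unique $x'\in\mathcal C(S)$ with $x\subseteq x'$ and $\sigma x'=y$); $+$-innocent ($s\prec s'$ and $pol(s)=+$ imply $\sigma(s)\prec\sigma(s')$); and $-$-innocent ($s\prec s'$ and $pol(s')=-$ imply $\sigma(s)\prec\sigma(s')$). A strategy from $A$ to $B$ is the case $N=\emptyset$; a strategy in $A$ is one from the empty game to $A$, i.e. $\sigma:S\to A$. A stopping strategy in $A$ is a pair $(\sigma,M_S)$ of a strategy $\sigma:S\to A$ and a subset $M_S\subseteq\mathcal C^\infty(S)$. **Rigid image.** Let $\sigma:S\to A$ be a strategy. For $s\in S$ let $f(s)$ be the pair $(\sigma[s],\alpha_s)$, where $\alpha_s$ is the partial order on the set $\sigma[s]$ transported from $\leq_S$ on $[s]$ along the bijection $[s]\cong\sigma[s]$. Let $S_0=\{f(s)\mid s\in S\}$, ordered by $(x,\alpha)\leq(x',\alpha')$ iff $x\subseteq x'$, $x$ is down-closed in $(x',\alpha')$ and $\alpha$ is the restriction of $\alpha'$ to $x$; a finite subset of $S_0$ is consistent iff it is the direct image under $f$ of a consistent set of $S$; polarities are inherited along $f$. Let $\sigma_1:S_0\to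 A$, $\sigma_1(f(s))=\sigma(s)$. Then $\sigma_1$ is a strategy, the rigid image of $\sigma$, and $\sigma=\sigma_1 f$ with $f:S\to S_0$ preserving causal dependency. The rigid image of the stopping strategy $(\sigma,M_S)$ is $(\sigma_1,fM_S)$, where $fM_S=\{fx\mid x\in M_S\}$. **Tests.** A test for $A$ is a bare strategy $\tau:T\to A^\perp\parallel N\parallel\boxplus$ from $A$ to $\boxplus$. Let $T_0$ be the event structure on the non-neutral events of $T$, with $\leq$ and $\mathrm{Con}$ restricted, let $\tau_0:T_0\to A^\perp\parallel\boxplus$ be the restriction of $\tau$ (a strategy), and let $M_0\subseteq\mathcal C^\infty(T_0)$ be the set of all $w_\downarrow=w\cap T_0$ with $w\in\mathcal C^\infty(T)$ $+$-maximal. Write $\checkmark$ for the event $\boxplus$ in $A^\perp\parallel\boxplus$. **Pairing.** For a strategy $\sigma:S\to A$, $x\in\mathcal C^\infty(S)$ and $y\in\mathcal C^\infty(T_0)$ with $\tau_0y=y_A\parallel y_{\boxplus}$, say $y\circledast x$ is defined iff $\sigma x=y_A$ and, on the induced bijection $\theta$ between $x\parallel y_{\boxplus}$ and $y$ (pairing elements with equal images), the transitive relation generated by $(u,v)\leq(u',v')$ if $u\leq u'$ or $v\leq v'$ is a partial order in which every element has only finitely many elements below it. **May and must.** $(\sigma,M_S)$ may pass $\tau$ iff there are $x\in\mathcal C^\infty(S)$, $y\in\mathcal C^\infty(T_0)$ with $y\circledast x$ defined and $\checkmark\in\tau_0y$. $(\sigma,M_S)$ must pass $\tau$ iff for all $x\in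 M_S$, $y\in M_0$ with $y\circledast x$ defined, $\checkmark\in\tau_0y$. Two stopping strategies in $A$ are `may' (respectively `must') equivalent iff the tests they may (respectively must) pass are the same. *)

theory Defs
  imports Main
begin

record 'e es =
  events :: "'e set"
  leq :: "('e \<times> 'e) set"
  Con :: "'e set set"

definition below :: "('e, 'm) es_scheme \<Rightarrow> 'e \<Rightarrow> 'e set" where
  "below E e = {e'. (e', e) \<in> leq E}"

definition event_structure :: "('e, 'm) es_scheme \<Rightarrow> bool" where
  "event_structure E \<longleftrightarrow>
     partial_order_on (events E) (leq E) \<and>
     Con E \<noteq> {} \<and>
     (\<forall>X\<in>Con E. finite X \<and> X \<subseteq> events E) \<and>
     (\<forall>e\<in>events E. finite (below E e)) \<and>
     (\<forall>e\<in>events E. {e} \<in> Con E) \<and>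
     (\<forall>X\<in>Con E. \<forall>Y. Y \<subseteq> X \<longrightarrow> Y \<in> Con E) \<and>
     (\<forall>X\<in>Con E. \<forall>e e'. (e, e') \<in> leq E \<and> e' \<in> X \<longrightarrow> insert e X \<in> Con E)"

definition confs :: "('e, 'm) es_scheme \<Rightarrow> 'e set set" where
  "confs E = {x. x \<subseteq> events E \<and>
     (\<forall>X. finite X \<and> X \<subseteq> x \<longrightarrow> X \<in> Con E) \<and>
     (\<forall>e e'. (e', e) \<in> leq E \<and> e \<in> x \<longrightarrow> e' \<in> x)}"

definition fin_confs :: "('e, 'm) es_scheme \<Rightarrow> 'e set set" where
  "fin_confs E = {x \<in> confs E. finite x}"

definition covers :: "('e, 'm) es_scheme \<Rightarrow> 'e \<Rightarrow> 'e \<Rightarrow> bool" where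
  "covers E e e' \<longleftrightarrow> (e, e') \<in> leq E \<and> e \<noteq> e' \<and>
     \<not> (\<exists>d. (e, d) \<in> leq E \<and> d \<noteq> e \<and> (d, e') \<in> leq E \<and> d \<noteq> e')"

definition total_map ::
  "('e, 'm) es_scheme \<Rightarrow> ('f, 'n) es_scheme \<Rightarrow> ('e \<Rightarrow> 'f) \<Rightarrow> bool" where
  "total_map E F f \<longleftrightarrow> f ` events E \<subseteq> events F \<and>
     (\<forall>x\<in>confs E. f ` x \<in> confs F \<and> inj_on f x)"

datatype polarity = Player | Opponent | Neutral

record 'e esp = "'e es" +
  pol :: "'e \<Rightarrow> polarity"

definition pol_map :: "'e esp \<Rightarrow> 'f esp \<Rightarrow> ('e \<Rightarrow> 'f) \<Rightarrow> bool" where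
  "pol_map E F f \<longleftrightarrow> total_map E F f \<and> (\<forall>e\<in>events E. pol F (f e) = pol E e)"

definition game :: "'e esp \<Rightarrow> bool" where
  "game A \<longleftrightarrow> event_structure A \<and> (\<forall>a\<in>events A. pol A a \<noteq> Neutral)"

definition sub_minus :: "'e esp \<Rightarrow> 'e set \<Rightarrow> 'e set \<Rightarrow> bool" where
  "sub_minus E x y \<longleftrightarrow> x \<subseteq> y \<and> (\<forall>e\<in>y - x. pol E e = Opponent)"

definition sub_plus :: "'e esp \<Rightarrow> 'e set \<Rightarrow> 'e set \<Rightarrow> bool" where
  "sub_plus E x y \<longleftrightarrow> x \<subseteq> y \<and> (\<forall>e\<in>y - x. pol E e = Player \<or> pol E e = Neutral)"

definition plus_maximal :: "'e esp \<Rightarrow> 'e set \<Rightarrow> bool" where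
  "plus_maximal E x \<longleftrightarrow> x \<in> confs E \<and> (\<forall>y\<in>confs E. sub_plus E x y \<longrightarrow> y = x)"

definition race_free :: "'e esp \<Rightarrow> bool" where
  "race_free A \<longleftrightarrow> (\<forall>x\<in>confs A. \<forall>y\<in>confs A. \<forall>z\<in>confs A.
     sub_plus A x y \<and> sub_minus A x z \<longrightarrow> y \<union> z \<in> confs A)"

fun opp :: "polarity \<Rightarrow> polarity" where
  "opp Player = Opponent"
| "opp Opponent = Player"
| "opp Neutral = Neutral"

definition dual :: "'e esp \<Rightarrow> 'e esp" where
  "dual A = A\<lparr>pol := \<lambda>a. opp (pol A a)\<rparr>"

definition par :: "'e esp \<Rightarrow> 'f esp \<Rightarrow> ('e + 'f) esp" where
  "par A B = \<lparr>
     events = events A <+> events B,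
     leq = {(Inl a, Inl a') | a a'. (a, a') \<in> leq A} \<union>
           {(Inr b, Inr b') | b b'. (b, b') \<in> leq B},
     Con = {X <+> Y | X Y. X \<in> Con A \<and> Y \<in> Con B},
     pol = case_sum (pol A) (pol B)\<rparr>"

definition tick_game :: "unit esp" where
  "tick_game = \<lparr>events = {()}, leq = {((), ())}, Con = {{}, {()}}, pol = \<lambda>_. Player\<rparr>"

definition receptive :: "'s esp \<Rightarrow> 'c esp \<Rightarrow> ('s \<Rightarrow> 'c) \<Rightarrow> bool" where
  "receptive S C \<sigma> \<longleftrightarrow> (\<forall>x\<in>fin_confs S. \<forall>y\<in>fin_confs C. sub_minus C (\<sigma> ` x) y \<longrightarrow>
     (\<exists>!x'. x' \<in> fin_confs S \<and> x \<subseteq> x' \<and> \<sigma> ` x' = y))"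

definition plus_innocent :: "'s esp \<Rightarrow> 'c esp \<Rightarrow> ('s \<Rightarrow> 'c) \<Rightarrow> bool" where
  "plus_innocent S C \<sigma> \<longleftrightarrow>
     (\<forall>s s'. covers S s s' \<and> pol S s = Player \<longrightarrow> covers C (\<sigma> s) (\<sigma> s'))"

definition minus_innocent :: "'s esp \<Rightarrow> 'c esp \<Rightarrow> ('s \<Rightarrow> 'c) \<Rightarrow> bool" where
  "minus_innocent S C \<sigma> \<longleftrightarrow>
     (\<forall>s s'. covers S s s' \<and> pol S s' = Opponent \<longrightarrow> covers C (\<sigma> s) (\<sigma> s'))"

definition strategic_map :: "'s esp \<Rightarrow> 'c esp \<Rightarrow> ('s \<Rightarrow> 'c) \<Rightarrow> bool" where
  "strategic_map S C \<sigma> \<longleftrightarrow> event_structure S \<and> pol_map S C \<sigma> \<and>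
     receptive S C \<sigma> \<and> plus_innocent S C \<sigma> \<and> minus_innocent S C \<sigma>"

definition bare_strategy ::
  "'a esp \<Rightarrow> 'b esp \<Rightarrow> 'n esp \<Rightarrow> 's esp \<Rightarrow> ('s \<Rightarrow> 'a + 'n + 'b) \<Rightarrow> bool" where
  "bare_strategy A B N S \<sigma> \<longleftrightarrow>
     event_structure N \<and> (\<forall>n\<in>events N. pol N n = Neutral) \<and>
     strategic_map S (par (dual A) (par N B)) \<sigma>"

text \<open>For a strategy in \<open>A\<close> the two empty components of the codomain are dropped.\<close>

definition strategy_in :: "'a esp \<Rightarrow> 's esp \<Rightarrow> ('s \<Rightarrow> 'a) \<Rightarrow> bool" where
  "strategy_in A S \<sigma> \<longleftrightarrow> strategic_map S A \<sigma>"

type_synonym ('s, 'a) stopping = "'s esp \<times> ('s \<Rightarrow> 'a) \<times> 's set set"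

fun stopping_strategy :: "'a esp \<Rightarrow> ('s, 'a) stopping \<Rightarrow> bool" where
  "stopping_strategy A (S, \<sigma>, M) \<longleftrightarrow> strategy_in A S \<sigma> \<and> M \<subseteq> confs S"

type_synonym 'a poset = "'a set \<times> ('a \<times> 'a) set"

definition rigid_fun :: "'s esp \<Rightarrow> ('s \<Rightarrow> 'a) \<Rightarrow> 's \<Rightarrow> 'a poset" where
  "rigid_fun S \<sigma> s =
     (\<sigma> ` below S s, {(\<sigma> u, \<sigma> v) | u v. u \<in> below S s \<and> v \<in> below S s \<and> (u, v) \<in> leq S})"

text \<open>
  The image map and the polarity are read off an arbitrary preimage under \<open>rigid_fun\<close>;
  the choice is irrelevant by \<open>rigid_map_rigid_fun\<close> and \<open>pol_rigid_es\<close> below.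
\<close>

definition rigid_map :: "'s esp \<Rightarrow> ('s \<Rightarrow> 'a) \<Rightarrow> 'a poset \<Rightarrow> 'a" where
  "rigid_map S \<sigma> p = \<sigma> (inv_into (events S) (rigid_fun S \<sigma>) p)"

definition rigid_es :: "'s esp \<Rightarrow> ('s \<Rightarrow> 'a) \<Rightarrow> 'a poset esp" where
  "rigid_es S \<sigma> = \<lparr>
     events = rigid_fun S \<sigma> ` events S,
     leq = {((x, \<alpha>), (x', \<alpha>')).
        (x, \<alpha>) \<in> rigid_fun S \<sigma> ` events S \<and> (x', \<alpha>') \<in> rigid_fun S \<sigma> ` events S \<and>
        x \<subseteq> x' \<and> (\<forall>a b. (a, b) \<in> \<alpha>' \<and> b \<in> x \<longrightarrow> a \<in> x) \<and> \<alpha> = Restr \<alpha>' x},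
     Con = {rigid_fun S \<sigma> ` X | X. X \<in> Con S},
     pol = \<lambda>p. pol S (inv_into (events S) (rigid_fun S \<sigma>) p)\<rparr>"

fun rigid_image :: "('s, 'a) stopping \<Rightarrow> ('a poset, 'a) stopping" where
  "rigid_image (S, \<sigma>, M) = (rigid_es S \<sigma>, rigid_map S \<sigma>, (\<lambda>x. rigid_fun S \<sigma> ` x) ` M)"

lemma below_confs:
  assumes E: "event_structure E" and e: "e \<in> events E"
  shows "below E e \<in> confs E"
proof -
  have po: "partial_order_on (events E) (leq E)"
    and sub: "\<And>X Y. X \<in> Con E \<Longrightarrow> Y \<subseteq> X \<Longrightarrow> Y \<in> Con E"
    and ext: "\<And>X d d'. X \<in> Con E \<Longrightarrow> (d, d') \<in> leq E \<Longrightarrow> d' \<in> X \<Longrightarrow> insert d X \<in> Con E"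
    using E unfolding event_structure_def by blast+
  have tr: "trans (leq E)" and rel: "leq E \<subseteq> events E \<times> events E"
    using po unfolding partial_order_on_def preorder_on_def by blast+
  have con: "insert e X \<in> Con E" if "finite X" "X \<subseteq> below E e" for X
    using that
  proof (induction X)
    case empty
    then show ?case using E e unfolding event_structure_def by blast
  next
    case (insert d X)
    then have "insert d (insert e X) \<in> Con E"
      by (intro ext[of _ d e]) (auto simp: below_def)
    then show ?case by (simp add: insert_commute)
  qed
  show ?thesis
    unfolding confs_def
  proof (intro CollectI conjI allI impI)
    show "below E e \<subseteq> events E" using rel by (auto simp: below_def)
    show "X \<in> Con E" if "finite X \<and> X \<subseteq> below E e" for X
      using con[of X] sub[of "insert e X" X] that by blast
    show "d' \<in> below E e" if "(d', d) \<in> leq E \<and> d \<in> below E e" for d d'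
      using that transD[OF tr] by (auto simp: below_def)
  qed
qed

lemma rigid_fun_eqD:
  assumes S: "event_structure S" and \<sigma>: "total_map S A \<sigma>"
    and s: "s \<in> events S" and s': "s' \<in> events S"
    and eq: "rigid_fun S \<sigma> s = rigid_fun S \<sigma> s'"
  shows "\<sigma> s = \<sigma> s'"
proof -
  have po: "partial_order_on (events S) (leq S)"
    using S unfolding event_structure_def by blast
  have anti: "antisym (leq S)" and rfl: "\<And>u. u \<in> events S \<Longrightarrow> (u, u) \<in> leq S"
    using po unfolding partial_order_on_def preorder_on_def refl_on_def by blast+
  have inj: "inj_on \<sigma> (below S s)"
    using \<sigma> below_confs[OF S s] unfolding total_map_def by blast
  have ss: "s \<in> below S s" "s' \<in> below S s'" using rfl s s' by (auto simp: below_def)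
  have "\<sigma> s \<in> \<sigma> ` below S s'" using eq ss by (auto simp: rigid_fun_def)
  then obtain w where w: "w \<in> below S s'" "\<sigma> s = \<sigma> w" by blast
  then have "(\<sigma> s, \<sigma> s') \<in> snd (rigid_fun S \<sigma> s')"
    using ss by (force simp: rigid_fun_def below_def)
  then have "(\<sigma> s, \<sigma> s') \<in> snd (rigid_fun S \<sigma> s)" using eq by simp
  then obtain u v where uv: "u \<in> below S s" "v \<in> below S s" "(u, v) \<in> leq S"
      "\<sigma> s = \<sigma> u" "\<sigma> s' = \<sigma> v"
    by (auto simp: rigid_fun_def)
  have "u = s" using inj uv ss by (metis inj_onD)
  then have "v = s" using uv anti by (auto simp: below_def dest: antisymD)
  then show ?thesis using uv by simp
qed

lemma rigid_map_rigid_fun: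
  assumes "strategy_in A S \<sigma>" "s \<in> events S"
  shows "rigid_map S \<sigma> (rigid_fun S \<sigma> s) = \<sigma> s"
proof -
  have "rigid_fun S \<sigma> s \<in> rigid_fun S \<sigma> ` events S" using assms(2) by blast
  then show ?thesis
    unfolding rigid_map_def
    using assms rigid_fun_eqD[of S A \<sigma>] inv_into_into f_inv_into_f
    unfolding strategy_in_def strategic_map_def pol_map_def by metis
qed

lemma pol_rigid_es:
  assumes "strategy_in A S \<sigma>" "s \<in> events S"
  shows "pol (rigid_es S \<sigma>) (rigid_fun S \<sigma> s) = pol S s"
proof -
  have "rigid_fun S \<sigma> s \<in> rigid_fun S \<sigma> ` events S" using assms(2) by blast
  then have "inv_into (events S) (rigid_fun S \<sigma>) (rigid_fun S \<sigma> s) \<in> events S"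
    by (rule inv_into_into)
  then show ?thesis
    using assms rigid_map_rigid_fun[OF assms]
    unfolding strategy_in_def strategic_map_def pol_map_def rigid_map_def
    by (simp add: rigid_es_def) metis
qed

definition test ::
  "'a esp \<Rightarrow> 'n esp \<Rightarrow> 't esp \<Rightarrow> ('t \<Rightarrow> 'a + 'n + unit) \<Rightarrow> bool" where
  "test A N T \<tau> \<longleftrightarrow> bare_strategy A tick_game N T \<tau>"

definition visible :: "'t esp \<Rightarrow> 't esp" where
  "visible T = (let V = {t \<in> events T. pol T t \<noteq> Neutral} in
     T\<lparr>events := V, leq := Restr (leq T) V, Con := {X \<in> Con T. X \<subseteq> V}\<rparr>)"

text \<open>
  The \<open>undefined\<close> branch is never reached on visible events, since \<open>\<tau>\<close> preserves polarity.
\<close>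

definition visible_map :: "('t \<Rightarrow> 'a + 'n + 'b) \<Rightarrow> 't \<Rightarrow> 'a + 'b" where
  "visible_map \<tau> t =
     (case \<tau> t of Inl a \<Rightarrow> Inl a | Inr (Inl n) \<Rightarrow> undefined | Inr (Inr b) \<Rightarrow> Inr b)"

definition test_stops :: "'t esp \<Rightarrow> 't set set" where
  "test_stops T = {w \<inter> events (visible T) | w. plus_maximal T w}"

text \<open>In the following, \<open>\<tau>\<^sub>0\<close> and \<open>T\<^sub>0\<close> stand for the visible part of a test.\<close>

definition pairing ::
  "('s \<Rightarrow> 'a) \<Rightarrow> 's set \<Rightarrow> ('t \<Rightarrow> 'a + unit) \<Rightarrow> 't set \<Rightarrow> (('s + unit) \<times> 't) set" where
  "pairing \<sigma> x \<tau>\<^sub>0 y =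
     {(u, v). u \<in> x <+> (Inr -` (\<tau>\<^sub>0 ` y)) \<and> v \<in> y \<and> map_sum \<sigma> id u = \<tau>\<^sub>0 v}"

definition pairing_order ::
  "'s esp \<Rightarrow> 't esp \<Rightarrow> (('s + unit) \<times> 't) set \<Rightarrow> ((('s + unit) \<times> 't) \<times> (('s + unit) \<times> 't)) set"
where
  "pairing_order S T\<^sub>0 \<theta> =
     {((u, v), (u', v')). (u, v) \<in> \<theta> \<and> (u', v') \<in> \<theta> \<and>
        ((u, u') \<in> leq (par S tick_game) \<or> (v, v') \<in> leq T\<^sub>0)}\<^sup>+"

definition pairing_defined ::
  "'s esp \<Rightarrow> ('s \<Rightarrow> 'a) \<Rightarrow> 's set \<Rightarrow> 't esp \<Rightarrow> ('t \<Rightarrow> 'a + unit) \<Rightarrow> 't set \<Rightarrow> bool" where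
  "pairing_defined S \<sigma> x T\<^sub>0 \<tau>\<^sub>0 y \<longleftrightarrow>
     \<sigma> ` x = Inl -` (\<tau>\<^sub>0 ` y) \<and>
     (let \<theta> = pairing \<sigma> x \<tau>\<^sub>0 y; R = pairing_order S T\<^sub>0 \<theta> in
        partial_order_on \<theta> R \<and> (\<forall>p\<in>\<theta>. finite {q. (q, p) \<in> R}))"

fun may_pass :: "('s, 'a) stopping \<Rightarrow> 't esp \<Rightarrow> ('t \<Rightarrow> 'a + 'n + unit) \<Rightarrow> bool" where
  "may_pass (S, \<sigma>, M) T \<tau> \<longleftrightarrow>
     (\<exists>x\<in>confs S. \<exists>y\<in>confs (visible T).
        pairing_defined S \<sigma> x (visible T) (visible_map \<tau>) y \<and> Inr () \<in> visible_map \<tau> ` y)"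

fun must_pass :: "('s, 'a) stopping \<Rightarrow> 't esp \<Rightarrow> ('t \<Rightarrow> 'a + 'n + unit) \<Rightarrow> bool" where
  "must_pass (S, \<sigma>, M) T \<tau> \<longleftrightarrow>
     (\<forall>x\<in>M. \<forall>y\<in>test_stops T.
        pairing_defined S \<sigma> x (visible T) (visible_map \<tau>) y \<longrightarrow> Inr () \<in> visible_map \<tau> ` y)"

text \<open>
  HOL cannot quantify over types inside a formula, so the types carrying the events of \<open>T\<close>
  and \<open>N\<close> in a test are parameters of the equivalences; a statement with these type variables
  free covers tests over arbitrary types.
\<close>

definition may_equivalent ::
  "('t \<times> 'n) itself \<Rightarrow> 'a esp \<Rightarrow> ('s, 'a) stopping \<Rightarrow> ('r, 'a) stopping \<Rightarrow> bool" where
  "may_equivalent _ A P Q \<longleftrightarrow>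
     (\<forall>(N :: 'n esp) (T :: 't esp) \<tau>. test A N T \<tau> \<longrightarrow> (may_pass P T \<tau> \<longleftrightarrow> may_pass Q T \<tau>))"

definition must_equivalent ::
  "('t \<times> 'n) itself \<Rightarrow> 'a esp \<Rightarrow> ('s, 'a) stopping \<Rightarrow> ('r, 'a) stopping \<Rightarrow> bool" where
  "must_equivalent _ A P Q \<longleftrightarrow>
     (\<forall>(N :: 'n esp) (T :: 't esp) \<tau>. test A N T \<tau> \<longrightarrow> (must_pass P T \<tau> \<longleftrightarrow> must_pass Q T \<tau>))"

end

(* The map f to the rigid image restricts to an order isomorphism from each configuration x of S
   onto f x, over the same configuration of A; hence y paired with x is defined iff y paired with
   f x is. This gives must equivalence and one half of may equivalence. For the other half a
   configuration of the rigid image need not be the image of one of S, but a finite one always is,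
   and a successful pairing can be cut down to the finitely many elements below the success event. *)

theory Submission
  imports Defs
begin

section \<open>Event structures, down-closures and configurations\<close>

lemma event_structure_leq:
  assumes "event_structure E"
  shows "trans (leq E)" "antisym (leq E)" "leq E \<subseteq> events E \<times> events E"
    "\<And>e. e \<in> events E \<Longrightarrow> (e, e) \<in> leq E"
proof -
  have "partial_order_on (events E) (leq E)"
    using assms unfolding event_structure_def by blast
  then show "trans (leq E)" "antisym (leq E)" "leq E \<subseteq> events E \<times> events E"
    "\<And>e. e \<in> events E \<Longrightarrow> (e, e) \<in> leq E"
    unfolding partial_order_on_def preorder_on_def refl_on_def by blast+
qed

lemma inj_on_below:
  assumes "event_structure E" "total_map E F g" "e \<in> events E"
  shows "inj_on g (below E e)"
  using assms(2) below_confs[OF assms(1,3)] unfolding total_map_def by blast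

lemma below_mono:
  assumes "event_structure E" "(d, e) \<in> leq E"
  shows "below E d \<subseteq> below E e"
  using transD[OF event_structure_leq(1)[OF assms(1)] _ assms(2)] by (auto simp: below_def)

lemma confsI:
  assumes "x \<subseteq> events E" "\<And>X. finite X \<Longrightarrow> X \<subseteq> x \<Longrightarrow> X \<in> Con E"
    and "\<And>d e. (d, e) \<in> leq E \<Longrightarrow> e \<in> x \<Longrightarrow> d \<in> x"
  shows "x \<in> confs E"
  using assms by (simp add: confs_def) metis

lemma confsD:
  assumes "x \<in> confs E"
  shows "x \<subseteq> events E" "\<And>X. finite X \<Longrightarrow> X \<subseteq> x \<Longrightarrow> X \<in> Con E"
    "\<And>d e. (d, e) \<in> leq E \<Longrightarrow> e \<in> x \<Longrightarrow> d \<in> x"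
  using assms unfolding confs_def by simp_all

text \<open>Down-closure of \<open>x'\<close> is asked only relative to \<open>x\<close>, since
  \<open>x\<close> is itself down-closed. This suits pairings, where a partner is at hand only for
  events of \<open>x\<close>.\<close>

lemma down_closed_subset_confs:
  assumes "x \<in> confs E" "x' \<subseteq> x"
    and "\<And>d e. (d, e) \<in> leq E \<Longrightarrow> d \<in> x \<Longrightarrow> e \<in> x' \<Longrightarrow> d \<in> x'"
  shows "x' \<in> confs E"
proof (rule confsI)
  show "x' \<subseteq> events E" using confsD(1)[OF assms(1)] assms(2) by simp
  show "X \<in> Con E" if "finite X" "X \<subseteq> x'" for X
    using confsD(2)[OF assms(1) that(1)] that(2) assms(2) by simp
  show "d \<in> x'" if "(d, e) \<in> leq E" "e \<in> x'" for d e
    using assms(3)[OF that(1) _ that(2)] confsD(3)[OF assms(1) that(1)] that(2) assms(2) by blast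
qed

text \<open>Events below a member of \<open>X\<close> can be added to \<open>X\<close> one at a time
  without losing consistency; smaller finite sets are then consistent as subsets.\<close>

lemma down_closure_confs:
  assumes E: "event_structure E" and X: "X \<in> Con E"
  shows "(\<Union>e\<in>X. below E e) \<in> confs E"
proof -
  have ext: "\<And>Z d e. Z \<in> Con E \<Longrightarrow> (d, e) \<in> leq E \<Longrightarrow> e \<in> Z \<Longrightarrow> insert d Z \<in> Con E"
    and sub: "\<And>Y Z. Z \<in> Con E \<Longrightarrow> Y \<subseteq> Z \<Longrightarrow> Y \<in> Con E"
    using E unfolding event_structure_def by blast+
  \<comment> \<open>Keeping \<open>X\<close> in the union strengthens the induction: the member of
    \<open>X\<close> that lies above the next event is still present when the extension axiom is
    applied.\<close>
  have con: "X \<union> Y \<in> Con E" if "finite Y" "Y \<subseteq> (\<Union>e\<in>X. below E e)" for Y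
    using that
  proof (induction Y)
    case (insert d Y)
    then obtain e where "e \<in> X" "(d, e) \<in> leq E" by (auto simp: below_def)
    then have "insert d (X \<union> Y) \<in> Con E"
      using insert by (intro ext[of _ d e]) auto
    then show ?case by simp
  qed (use X in simp)
  have "Y \<in> Con E" if "finite Y" "Y \<subseteq> (\<Union>e\<in>X. below E e)" for Y
    using sub[OF con[OF that]] by blast
  moreover have "(\<Union>e\<in>X. below E e) \<subseteq> events E"
    using event_structure_leq(3)[OF E] by (auto simp: below_def)
  moreover have "d \<in> (\<Union>e\<in>X. below E e)" if "(d, e) \<in> leq E" "e \<in> (\<Union>e\<in>X. below E e)" for d e
    using that transD[OF event_structure_leq(1)[OF E] that(1)] by (auto simp: below_def)
  ultimately show ?thesis by (intro confsI)
qed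

section \<open>The causal order of the rigid image\<close>

text \<open>A pair in the order of \<open>s\<close> with both ends in the image of
  \<open>below S u\<close> could a priori come from events not below \<open>u\<close>. Injectivity
  of \<open>\<sigma>\<close> on \<open>below S s\<close> excludes this.\<close>

lemma rigid_fun_restrict:
  assumes S: "event_structure S" and \<sigma>: "total_map S A \<sigma>" and us: "(u, s) \<in> leq S"
  shows "snd (rigid_fun S \<sigma> u) = Restr (snd (rigid_fun S \<sigma> s)) (\<sigma> ` below S u)"
proof -
  have "s \<in> events S" using us event_structure_leq(3)[OF S] by blast
  then have inj: "inj_on \<sigma> (below S s)" by (rule inj_on_below[OF S \<sigma>])
  have sub: "below S u \<subseteq> below S s"
    by (rule below_mono[OF S us])
  show ?thesis
  proof (intro subset_antisym subrelI)
    fix a b assume "(a, b) \<in> Restr (snd (rigid_fun S \<sigma> s)) (\<sigma> ` below S u)"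
    then obtain v w v' w' where vw: "a = \<sigma> v" "b = \<sigma> w" "v \<in> below S s" "w \<in> below S s"
        "(v, w) \<in> leq S" "a = \<sigma> v'" "b = \<sigma> w'" "v' \<in> below S u" "w' \<in> below S u"
      by (auto simp: rigid_fun_def)
    then have "v = v'" "w = w'" using inj sub by (metis inj_onD subsetD)+
    then show "(a, b) \<in> snd (rigid_fun S \<sigma> u)" using vw by (auto simp: rigid_fun_def)
  qed (use sub in \<open>auto simp: rigid_fun_def\<close>)
qed

text \<open>Together with \<open>rigid_fun_restrict\<close> this yields that
  \<open>rigid_fun\<close> preserves causal dependency.\<close>

lemma rigid_fun_down_closed:
  assumes S: "event_structure S" and \<sigma>: "total_map S A \<sigma>" and us: "(u, s) \<in> leq S"
    and ab: "(a, b) \<in> snd (rigid_fun S \<sigma> s)" "b \<in> \<sigma> ` below S u"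
  shows "a \<in> \<sigma> ` below S u"
proof -
  have "s \<in> events S" using us event_structure_leq(3)[OF S] by blast
  then have inj: "inj_on \<sigma> (below S s)" by (rule inj_on_below[OF S \<sigma>])
  have sub: "below S u \<subseteq> below S s"
    by (rule below_mono[OF S us])
  obtain v w w' where vw: "a = \<sigma> v" "b = \<sigma> w" "w \<in> below S s" "(v, w) \<in> leq S"
      "b = \<sigma> w'" "w' \<in> below S u"
    using ab by (auto simp: rigid_fun_def)
  then have "w = w'" using inj sub by (metis inj_onD subsetD)
  then have "v \<in> below S u"
    using vw below_mono[OF S, of w u] by (auto simp: below_def)
  then show ?thesis using vw by blast
qed

text \<open>This is rigidity: the events below an image are exactly the images of the events below.
  For the direction from left to right, the top element of \<open>p\<close> is matched with an event
  \<open>u\<close> below \<open>s\<close>, and \<open>p\<close> is recovered as the part of the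
  order of \<open>s\<close> that lies below \<open>\<sigma> u\<close>.\<close>

lemma leq_rigid_es_iff:
  assumes S: "event_structure S" and \<sigma>: "total_map S A \<sigma>" and s: "s \<in> events S"
  shows "(p, rigid_fun S \<sigma> s) \<in> leq (rigid_es S \<sigma>) \<longleftrightarrow>
    (\<exists>u. (u, s) \<in> leq S \<and> p = rigid_fun S \<sigma> u)"
proof
  assume "\<exists>u. (u, s) \<in> leq S \<and> p = rigid_fun S \<sigma> u"
  then obtain u where u: "(u, s) \<in> leq S" "p = rigid_fun S \<sigma> u" by blast
  have "below S u \<subseteq> below S s"
    by (rule below_mono[OF S u(1)])
  moreover have "u \<in> events S" using u event_structure_leq(3)[OF S] by blast
  moreover obtain \<alpha> \<beta> where "rigid_fun S \<sigma> u = (\<sigma> ` below S u, \<alpha>)"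
      "rigid_fun S \<sigma> s = (\<sigma> ` below S s, \<beta>)"
    by (simp add: rigid_fun_def)
  ultimately show "(p, rigid_fun S \<sigma> s) \<in> leq (rigid_es S \<sigma>)"
    using s u rigid_fun_restrict[OF S \<sigma> u(1)] rigid_fun_down_closed[OF S \<sigma> u(1)]
    by (auto simp: rigid_es_def image_iff) metis+
next
  assume le: "(p, rigid_fun S \<sigma> s) \<in> leq (rigid_es S \<sigma>)"
  obtain \<alpha> where fs: "rigid_fun S \<sigma> s = (\<sigma> ` below S s, \<alpha>)"
    by (simp add: rigid_fun_def)
  obtain r where r: "r \<in> events S" "p = rigid_fun S \<sigma> r"
    using le by (auto simp: rigid_es_def)
  obtain \<beta> where fr: "rigid_fun S \<sigma> r = (\<sigma> ` below S r, \<beta>)"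
    by (simp add: rigid_fun_def)
  have sub: "\<sigma> ` below S r \<subseteq> \<sigma> ` below S s"
    and closed: "\<And>a b. (a, b) \<in> \<alpha> \<Longrightarrow> b \<in> \<sigma> ` below S r \<Longrightarrow> a \<in> \<sigma> ` below S r"
    and \<beta>: "\<beta> = Restr \<alpha> (\<sigma> ` below S r)"
    using le unfolding r fs fr rigid_es_def by (simp_all, blast)
  have rr: "r \<in> below S r" using event_structure_leq(4)[OF S] r by (simp add: below_def)
  \<comment> \<open>The given preimage \<open>r\<close> of \<open>p\<close> need not lie below
    \<open>s\<close>. The event \<open>u\<close> below \<open>s\<close> over the same point of the
    game serves as another preimage.\<close>
  then obtain u where u: "(u, s) \<in> leq S" "\<sigma> r = \<sigma> u" using sub by (auto simp: below_def)
  have inj: "inj_on \<sigma> (below S s)" by (rule inj_on_below[OF S \<sigma> s])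
  \<comment> \<open>Both sides are the set of \<open>\<alpha>\<close>-predecessors of
    \<open>\<sigma> u\<close>: on the left because \<open>\<alpha>\<close> is transported from
    \<open>S\<close>, on the right because \<open>\<beta>\<close> is a down-closed restriction of
    \<open>\<alpha>\<close> with top \<open>\<sigma> r\<close>.\<close>
  have "\<sigma> ` below S u = \<sigma> ` below S r"
  proof (intro subset_antisym subsetI)
    fix a assume "a \<in> \<sigma> ` below S u"
    then obtain v where v: "a = \<sigma> v" "(v, u) \<in> leq S" by (auto simp: below_def)
    then have "(v, s) \<in> leq S" using below_mono[OF S u(1)] by (auto simp: below_def)
    then have "(a, \<sigma> u) \<in> \<alpha>"
      using v u fs by (auto simp: rigid_fun_def below_def)
    then show "a \<in> \<sigma> ` below S r" using closed u rr by (metis imageI)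
  next
    fix a assume a: "a \<in> \<sigma> ` below S r"
    then have "(a, \<sigma> r) \<in> \<beta>" using fr rr by (auto simp: rigid_fun_def below_def)
    then have "(a, \<sigma> u) \<in> \<alpha>" using \<beta> u by simp
    then obtain v w where vw: "(v, w) \<in> leq S" "w \<in> below S s" "a = \<sigma> v" "\<sigma> u = \<sigma> w"
      using fs by (auto simp: rigid_fun_def)
    have "w = u" using inj vw u by (auto simp: below_def dest: inj_onD)
    then show "a \<in> \<sigma> ` below S u" using vw by (auto simp: below_def)
  qed
  moreover have "snd (rigid_fun S \<sigma> u) = Restr \<alpha> (\<sigma> ` below S u)"
    using rigid_fun_restrict[OF S \<sigma> u(1)] fs by simp
  moreover have "fst (rigid_fun S \<sigma> u) = \<sigma> ` below S u" by (simp add: rigid_fun_def)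
  ultimately have "rigid_fun S \<sigma> u = p" using r fr \<beta> by (simp add: prod_eq_iff)
  then show "\<exists>u. (u, s) \<in> leq S \<and> p = rigid_fun S \<sigma> u" using u by blast
qed

section \<open>Configurations of a strategy and of its rigid image\<close>

text \<open>In general the hypothesis \<open>le\<close> only gives some \<open>u\<close> below
  \<open>s'\<close> with the same rigid image as \<open>s\<close>. Inside one configuration
  \<open>u\<close> and \<open>s\<close> coincide, since \<open>\<sigma>\<close> is injective there
  and identifies them.\<close>

lemma rigid_fun_reflects:
  assumes S: "event_structure S" and \<sigma>: "total_map S A \<sigma>" and x: "x \<in> confs S"
    and s: "s \<in> x" and s': "s' \<in> x"
    and le: "(rigid_fun S \<sigma> s, rigid_fun S \<sigma> s') \<in> leq (rigid_es S \<sigma>)"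
  shows "(s, s') \<in> leq S"
proof -
  have ev: "s \<in> events S" "s' \<in> events S" using s s' confsD(1)[OF x] by auto
  obtain u where u: "(u, s') \<in> leq S" "rigid_fun S \<sigma> s = rigid_fun S \<sigma> u"
    using le leq_rigid_es_iff[OF S \<sigma> ev(2)] by blast
  then have "u \<in> x" "u \<in> events S" using confsD(1,3)[OF x] s' by blast+
  moreover have "\<sigma> s = \<sigma> u" using rigid_fun_eqD[OF S \<sigma> ev(1) \<open>u \<in> events S\<close> u(2)] .
  ultimately have "u = s" using s x \<sigma> by (auto simp: total_map_def dest: inj_onD)
  then show ?thesis using u by simp
qed

text \<open>Down-closure is rigidity, from \<open>leq_rigid_es_iff\<close>; consistency holds
  because a finite subset of the image is the image of a finite subset of \<open>x\<close>.\<close>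

lemma rigid_fun_confs:
  assumes S: "event_structure S" and \<sigma>: "total_map S A \<sigma>" and x: "x \<in> confs S"
  shows "rigid_fun S \<sigma> ` x \<in> confs (rigid_es S \<sigma>)"
proof -
  have ev: "x \<subseteq> events S" by (rule confsD(1)[OF x])
  show ?thesis
  proof (rule confsI)
    show "rigid_fun S \<sigma> ` x \<subseteq> events (rigid_es S \<sigma>)"
      using ev by (auto simp: rigid_es_def)
  next
    fix X assume "finite X" "X \<subseteq> rigid_fun S \<sigma> ` x"
    then obtain Y where "Y \<subseteq> x" "finite Y" "X = rigid_fun S \<sigma> ` Y"
      by (blast dest: finite_subset_image)
    then show "X \<in> Con (rigid_es S \<sigma>)"
      using confsD(2)[OF x, of Y] by (auto simp: rigid_es_def)
  next
    fix p q assume pq: "(p, q) \<in> leq (rigid_es S \<sigma>)" "q \<in> rigid_fun S \<sigma> ` x"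
    then obtain s where s: "s \<in> x" "q = rigid_fun S \<sigma> s" by blast
    then obtain u where "(u, s) \<in> leq S" "p = rigid_fun S \<sigma> u"
      using pq ev leq_rigid_es_iff[OF S \<sigma>, of s p] by blast
    then show "p \<in> rigid_fun S \<sigma> ` x" using confsD(3)[OF x] s by blast
  qed
qed

text \<open>Finiteness makes \<open>z\<close> itself a consistent set, hence the image of some
  consistent \<open>X\<close>. Passing to the down-closure of \<open>X\<close> adds only events
  whose images are already in \<open>z\<close>, by rigidity.\<close>

lemma finite_rigid_conf_lift:
  assumes S: "event_structure S" and \<sigma>: "total_map S A \<sigma>"
    and z: "z \<in> confs (rigid_es S \<sigma>)" "finite z"
  obtains x where "x \<in> confs S" "rigid_fun S \<sigma> ` x = z"
proof -
  have "z \<in> Con (rigid_es S \<sigma>)" by (rule confsD(2)[OF z]) simp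
  then obtain X where X: "X \<in> Con S" "z = rigid_fun S \<sigma> ` X" by (auto simp: rigid_es_def)
  have ev: "X \<subseteq> events S" using X S by (simp add: event_structure_def)
  have "rigid_fun S \<sigma> ` (\<Union>e\<in>X. below S e) = z"
  proof (intro subset_antisym subsetI)
    fix p assume "p \<in> rigid_fun S \<sigma> ` (\<Union>e\<in>X. below S e)"
    then obtain s e where "p = rigid_fun S \<sigma> s" "e \<in> X" "(s, e) \<in> leq S"
      by (auto simp: below_def)
    then have "(p, rigid_fun S \<sigma> e) \<in> leq (rigid_es S \<sigma>)" "rigid_fun S \<sigma> e \<in> z"
      using leq_rigid_es_iff[OF S \<sigma>, of e p] ev X by blast+
    then show "p \<in> z" by (rule confsD(3)[OF z(1)])
  qed (use X ev event_structure_leq(4)[OF S] in \<open>fastforce simp: below_def\<close>)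
  then show ?thesis using that down_closure_confs[OF S X(1)] by blast
qed

section \<open>Transport of pairings and their restriction to finite parts\<close>

lemma trancl_map:
  assumes "(p, q) \<in> r\<^sup>+" and "\<And>a b. (a, b) \<in> r \<Longrightarrow> (h a, h b) \<in> r'"
  shows "(h p, h q) \<in> r'\<^sup>+"
  using assms(1) by induction (auto intro: assms(2) trancl_into_trancl)

text \<open>The cases of interest are \<open>k\<close> an order isomorphism, its inverse, or an inclusion.\<close>

lemma pairing_defined_pullback:
  fixes S :: "'s esp" and S' :: "'r esp" and T :: "'t esp" and k :: "'s \<Rightarrow> 'r"
  assumes def: "pairing_defined S' \<sigma>' x' T \<tau> y'"
    and eq: "\<sigma> ` x = Inl -` (\<tau> ` y)"
    and y: "y \<subseteq> y'"
    and k: "k ` x \<subseteq> x'" "inj_on k x"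
    and \<sigma>: "\<And>s. s \<in> x \<Longrightarrow> \<sigma>' (k s) = \<sigma> s"
    and mono: "\<And>s t. s \<in> x \<Longrightarrow> t \<in> x \<Longrightarrow> (s, t) \<in> leq S \<Longrightarrow> (k s, k t) \<in> leq S'"
    and refl: "\<And>s. s \<in> x \<Longrightarrow> (s, s) \<in> leq S"
  shows "pairing_defined S \<sigma> x T \<tau> y"
proof -
  define \<theta> where "\<theta> = pairing \<sigma> x \<tau> y"
  define \<theta>' where "\<theta>' = pairing \<sigma>' x' \<tau> y'"
  define r where "r = {((u, v), (u', v')). (u, v) \<in> \<theta> \<and> (u', v') \<in> \<theta> \<and>
        ((u, u') \<in> leq (par S tick_game) \<or> (v, v') \<in> leq T)}"
  define r' where "r' = {((u, v), (u', v')). (u, v) \<in> \<theta>' \<and> (u', v') \<in> \<theta>' \<and>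
        ((u, u') \<in> leq (par S' tick_game) \<or> (v, v') \<in> leq T)}"
  have R: "pairing_order S T \<theta> = r\<^sup>+" "pairing_order S' T \<theta>' = r'\<^sup>+"
    by (simp_all add: pairing_order_def r_def r'_def)
  \<comment> \<open>These two properties pass back along an injective monotone map. Reflexivity and
    transitivity of \<open>r\<^sup>+\<close> are obtained directly.\<close>
  have po': "antisym (r'\<^sup>+)" and fin': "\<And>p. p \<in> \<theta>' \<Longrightarrow> finite {q. (q, p) \<in> r'\<^sup>+}"
    using def unfolding pairing_defined_def Let_def \<theta>'_def[symmetric] R partial_order_on_def
    by blast+
  \<comment> \<open>The map of pairings induced by \<open>k\<close>: it fixes the success event and
    the events of \<open>T\<close>. It is injective on \<open>\<theta>\<close> because
    \<open>k\<close> is injective on \<open>x\<close>.\<close>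
  define h :: "('s + unit) \<times> 't \<Rightarrow> ('r + unit) \<times> 't"
    where "h = map_prod (map_sum k id) id"
  have h\<theta>: "h p \<in> \<theta>'" if "p \<in> \<theta>" for p
  proof -
    obtain u v where p: "p = (u, v)" "u \<in> x <+> Inr -` (\<tau> ` y)" "v \<in> y" "map_sum \<sigma> id u = \<tau> v"
      using \<open>p \<in> \<theta>\<close> by (auto simp: \<theta>_def pairing_def)
    moreover have "v \<in> y'" "\<tau> ` y \<subseteq> \<tau> ` y'" using y p(3) by blast+
    ultimately show ?thesis
      using k(1) \<sigma> by (cases u) (auto simp: \<theta>'_def pairing_def h_def)
  qed
  have inj: "inj_on h \<theta>"
  proof (rule inj_onI)
    fix p q assume pq: "p \<in> \<theta>" "q \<in> \<theta>" "h p = h q"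
    obtain u v u' v' where p: "p = (u, v)" "q = (u', v')" by (cases p; cases q) auto
    have "u \<in> x <+> UNIV" "u' \<in> x <+> UNIV" "map_sum k id u = map_sum k id u'" "v = v'"
      using pq unfolding p \<theta>_def pairing_def h_def by auto
    then show "p = q" using inj_onD[OF k(2)] unfolding p by (cases u; cases u') auto
  qed
  have hr: "(h p, h q) \<in> r'" if "(p, q) \<in> r" for p q
  proof -
    obtain u v u' v' where pq: "p = (u, v)" "q = (u', v')" by (cases p; cases q) auto
    have \<theta>: "(u, v) \<in> \<theta>" "(u', v') \<in> \<theta>"
      and le: "(u, u') \<in> leq (par S tick_game) \<or> (v, v') \<in> leq T"
      using that by (auto simp: r_def pq)
    have "(map_sum k id u, map_sum k id u') \<in> leq (par S' tick_game)"
      if "(u, u') \<in> leq (par S tick_game)"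
      using that \<theta> mono by (auto simp: par_def \<theta>_def pairing_def)
    then show ?thesis using \<theta>[THEN h\<theta>] le by (auto simp: r'_def pq h_def)
  qed
  have sub: "r\<^sup>+ \<subseteq> \<theta> \<times> \<theta>"
    by (rule trancl_subset_Sigma) (auto simp: r_def)
  have refl': "(p, p) \<in> r\<^sup>+" if "p \<in> \<theta>" for p
    using that refl
    by (intro r_into_trancl) (auto simp: r_def \<theta>_def pairing_def par_def tick_game_def)
  have hR: "(h p, h q) \<in> r'\<^sup>+" if "(p, q) \<in> r\<^sup>+" for p q
    using that hr by (rule trancl_map)
  have "antisym (r\<^sup>+)"
  proof (rule antisymI)
    fix p q assume pq: "(p, q) \<in> r\<^sup>+" "(q, p) \<in> r\<^sup>+"
    then have "h p = h q" using hR po' by (blast dest: antisymD)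
    then show "p = q" using inj pq sub by (blast dest: inj_onD)
  qed
  then have po: "partial_order_on \<theta> (r\<^sup>+)"
    using sub refl' trans_trancl[of r]
    unfolding partial_order_on_def preorder_on_def refl_on_def by blast
  \<comment> \<open>The lower set of \<open>p\<close> embeds by \<open>h\<close> into the finite
    lower set of \<open>h p\<close>.\<close>
  have "finite {q. (q, p) \<in> r\<^sup>+}" if "p \<in> \<theta>" for p
  proof (rule inj_on_finite)
    show "inj_on h {q. (q, p) \<in> r\<^sup>+}" using inj sub by (blast intro: inj_on_subset)
    show "h ` {q. (q, p) \<in> r\<^sup>+} \<subseteq> {q. (q, h p) \<in> r'\<^sup>+}" using hR by blast
    show "finite {q. (q, h p) \<in> r'\<^sup>+}" using fin' h\<theta> that by blast
  qed
  then show ?thesis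
    using po eq unfolding pairing_defined_def Let_def \<theta>_def[symmetric] R by blast
qed

text \<open>On \<open>x\<close> the map to the rigid image is an order isomorphism over the game, so
  the pullback lemma applies along it and along its inverse.\<close>

lemma pairing_defined_rigid:
  assumes st: "strategy_in A S \<sigma>" and x: "x \<in> confs S"
  shows "pairing_defined (rigid_es S \<sigma>) (rigid_map S \<sigma>) (rigid_fun S \<sigma> ` x) T \<tau> y \<longleftrightarrow>
    pairing_defined S \<sigma> x T \<tau> y"
    (is "pairing_defined ?S\<^sub>0 ?\<sigma>\<^sub>0 (?f ` x) T \<tau> y \<longleftrightarrow> _")
proof -
  have S: "event_structure S" and \<sigma>: "total_map S A \<sigma>"
    using st by (simp_all add: strategy_in_def strategic_map_def pol_map_def)
  have ev: "x \<subseteq> events S" by (rule confsD(1)[OF x])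
  have map: "?\<sigma>\<^sub>0 (?f s) = \<sigma> s" if "s \<in> x" for s
    using rigid_map_rigid_fun[OF st] that ev by blast
  have img: "?\<sigma>\<^sub>0 ` ?f ` x = \<sigma> ` x" using map by force
  have inj\<sigma>: "inj_on \<sigma> x" using \<sigma> x by (simp add: total_map_def)
  \<comment> \<open>On \<open>x\<close>, \<open>\<sigma>\<close> factors through \<open>?f\<close>,
    which therefore inherits injectivity.\<close>
  then have inj: "inj_on ?f x" using map by (metis inj_onD inj_onI)
  have le: "(?f s, ?f t) \<in> leq ?S\<^sub>0 \<longleftrightarrow> (s, t) \<in> leq S" if "s \<in> x" "t \<in> x" for s t
    using that rigid_fun_reflects[OF S \<sigma> x] leq_rigid_es_iff[OF S \<sigma>] ev by blast
  have refl: "(s, s) \<in> leq S" if "s \<in> x" for s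
    using event_structure_leq(4)[OF S] that ev by blast
  show ?thesis
  proof
    assume d: "pairing_defined ?S\<^sub>0 ?\<sigma>\<^sub>0 (?f ` x) T \<tau> y"
    then have "\<sigma> ` x = Inl -` (\<tau> ` y)" using img by (simp add: pairing_defined_def)
    then show "pairing_defined S \<sigma> x T \<tau> y"
      by (rule pairing_defined_pullback[OF d, where k = ?f]) (use inj map le refl in auto)
  next
    assume d: "pairing_defined S \<sigma> x T \<tau> y"
    then have "?\<sigma>\<^sub>0 ` ?f ` x = Inl -` (\<tau> ` y)" using img by (simp add: pairing_defined_def)
    then show "pairing_defined ?S\<^sub>0 ?\<sigma>\<^sub>0 (?f ` x) T \<tau> y"
      \<comment> \<open>The inverse is taken relative to \<open>x\<close>: on all events of
        \<open>S\<close>, \<open>?f\<close> may identify distinct events.\<close>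
      by (rule pairing_defined_pullback[OF d, where k = "inv_into x ?f"])
        (use inj map le refl in \<open>auto simp: inj_on_def\<close>)
  qed
qed

text \<open>The pairs below the one containing the success event are finitely many. Since the order
  on pairs contains both causal orders, the two projections of this lower set are again
  down-closed.\<close>

lemma pairing_defined_finite:
  fixes S :: "'s esp" and T :: "'t esp"
  assumes x: "x \<in> confs S" and y: "y \<in> confs T"
    and refl: "\<And>s. s \<in> x \<Longrightarrow> (s, s) \<in> leq S"
    and d: "pairing_defined S \<sigma> x T \<tau> y" and tick: "Inr () \<in> \<tau> ` y"
  obtains x' y' where "x' \<in> confs S" "finite x'" "y' \<in> confs T"
    "pairing_defined S \<sigma> x' T \<tau> y'" "Inr () \<in> \<tau> ` y'"
proof -
  define \<theta> where "\<theta> = pairing \<sigma> x \<tau> y"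
  define R where "R = pairing_order S T \<theta>"
  have po: "partial_order_on \<theta> R" and fin: "\<And>p. p \<in> \<theta> \<Longrightarrow> finite {q. (q, p) \<in> R}"
    and eq: "\<sigma> ` x = Inl -` (\<tau> ` y)"
    using d unfolding pairing_defined_def Let_def \<theta>_def[symmetric] R_def[symmetric] by blast+
  have rfl: "\<And>p. p \<in> \<theta> \<Longrightarrow> (p, p) \<in> R" and sub: "R \<subseteq> \<theta> \<times> \<theta>" and tr: "trans R"
    using po unfolding partial_order_on_def preorder_on_def refl_on_def by blast+
  have step: "((u, v), (u', v')) \<in> R" if "(u, v) \<in> \<theta>" "(u', v') \<in> \<theta>"
      "(u, u') \<in> leq (par S tick_game) \<or> (v, v') \<in> leq T" for u v u' v'
    unfolding R_def pairing_order_def using that by (intro r_into_trancl) auto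
  obtain t where t: "t \<in> y" "\<tau> t = Inr ()" using tick by force
  \<comment> \<open>The success event on the left paired with the event \<open>t\<close> of the test
    that realises it.\<close>
  define p :: "('s + unit) \<times> 't" where "p = (Inr (), t)"
  have p\<theta>: "p \<in> \<theta>" using t by (force simp: p_def \<theta>_def pairing_def)
  define D where "D = {q. (q, p) \<in> R}"
  have D\<theta>: "D \<subseteq> \<theta>" and pD: "p \<in> D" and finD: "finite D"
    using sub rfl[OF p\<theta>] fin[OF p\<theta>] by (auto simp: D_def)
  have Dstep: "q \<in> D" if "(q, q') \<in> R" "q' \<in> D" for q q'
    using that tr by (auto simp: D_def dest: transD)
  define x' where "x' = Inl -` (fst ` D)"
  define y' where "y' = snd ` D"
  have x'x: "x' \<subseteq> x" and y'y: "y' \<subseteq> y"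
    using D\<theta> by (auto simp: x'_def y'_def \<theta>_def pairing_def)
  \<comment> \<open>By \<open>eq\<close>, every event of \<open>x\<close> occurs in a pair;
    \<open>partner_y\<close> is the counterpart for \<open>y\<close>. A causal predecessor on either
    side thus lifts to a pair, which \<open>step\<close> places below the given one and so in
    \<open>D\<close>.\<close>
  have partner_x: "\<exists>v. (Inl s, v) \<in> \<theta>" if "s \<in> x" for s
  proof -
    have "\<sigma> s \<in> Inl -` (\<tau> ` y)" using that eq by blast
    then obtain v where "v \<in> y" "\<tau> v = Inl (\<sigma> s)" by force
    then show ?thesis using that by (force simp: \<theta>_def pairing_def)
  qed
  have partner_y: "\<exists>u. (u, v) \<in> \<theta>" if "v \<in> y" for v
  proof (cases "\<tau> v")
    case (Inl a)
    then have "a \<in> \<sigma> ` x" unfolding eq using that by force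
    then show ?thesis using Inl that by (force simp: \<theta>_def pairing_def)
  next
    case (Inr b)
    then have "(Inr (), v) \<in> \<theta>" using that by (force simp: \<theta>_def pairing_def)
    then show ?thesis by blast
  qed
  have "x' \<in> confs S"
  proof (rule down_closed_subset_confs[OF x x'x])
    fix d e assume *: "(d, e) \<in> leq S" "d \<in> x" "e \<in> x'"
    obtain v where v: "(Inl d, v) \<in> \<theta>" using partner_x *(2) by blast
    obtain w where w: "(Inl e, w) \<in> D" using *(3) by (force simp: x'_def)
    have "((Inl d, v), (Inl e, w)) \<in> R"
      using step[OF v, of "Inl e" w] w D\<theta> *(1) by (auto simp: par_def)
    then show "d \<in> x'" using Dstep[OF _ w] by (force simp: x'_def)
  qed
  moreover have "y' \<in> confs T"
  proof (rule down_closed_subset_confs[OF y y'y])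
    fix d e assume *: "(d, e) \<in> leq T" "d \<in> y" "e \<in> y'"
    obtain u where u: "(u, d) \<in> \<theta>" using partner_y *(2) by blast
    obtain w where w: "(w, e) \<in> D" using *(3) by (force simp: y'_def)
    have "((u, d), (w, e)) \<in> R"
      using step[OF u, of w e] w D\<theta> *(1) by auto
    then show "d \<in> y'" using Dstep[OF _ w] by (force simp: y'_def)
  qed
  moreover have "finite x'" using finD by (auto simp: x'_def intro: finite_vimageI)
  moreover have "Inr () \<in> \<tau> ` y'" using pD t by (force simp: y'_def p_def)
  moreover have "pairing_defined S \<sigma> x' T \<tau> y'"
  \<comment> \<open>The inclusion case of the pullback: the smaller pairing inherits its order
    properties from the larger one, so only the matching of images over the game remains.\<close>
  proof (rule pairing_defined_pullback[OF d _ y'y, where k = id])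
    show "\<sigma> ` x' = Inl -` (\<tau> ` y')"
    proof (intro subset_antisym subsetI)
      fix a assume "a \<in> \<sigma> ` x'"
      then obtain s v where "a = \<sigma> s" "(Inl s, v) \<in> D" by (force simp: x'_def)
      then show "a \<in> Inl -` (\<tau> ` y')" using D\<theta> by (force simp: y'_def \<theta>_def pairing_def)
    next
      fix a assume "a \<in> Inl -` (\<tau> ` y')"
      then obtain u v where uv: "Inl a = \<tau> v" "(u, v) \<in> D" by (force simp: y'_def)
      then have "map_sum \<sigma> id u = Inl a" using D\<theta> by (auto simp: \<theta>_def pairing_def)
      then obtain s where "u = Inl s" "a = \<sigma> s" by (cases u) auto
      then show "a \<in> \<sigma> ` x'" using uv by (force simp: x'_def)
    qed
  qed (use x'x refl in auto)
  ultimately show ?thesis using that by blast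
qed

theorem proposition11p2:
  fixes A :: "'a esp" and S :: "'s esp" and \<sigma> :: "'s \<Rightarrow> 'a" and M\<^sub>S :: "'s set set"
  assumes "game A" and "race_free A"
    and "stopping_strategy A (S, \<sigma>, M\<^sub>S)"
  shows "may_equivalent TYPE('t \<times> 'n) A (S, \<sigma>, M\<^sub>S) (rigid_image (S, \<sigma>, M\<^sub>S)) \<and>
         must_equivalent TYPE('t \<times> 'n) A (S, \<sigma>, M\<^sub>S) (rigid_image (S, \<sigma>, M\<^sub>S))"
proof -
  have st: "strategy_in A S \<sigma>" and M: "M\<^sub>S \<subseteq> confs S" using assms(3) by auto
  have S: "event_structure S" and \<sigma>: "total_map S A \<sigma>"
    using st by (simp_all add: strategy_in_def strategic_map_def pol_map_def)
  have "may_pass (S, \<sigma>, M\<^sub>S) T \<tau> \<longleftrightarrow> may_pass (rigid_image (S, \<sigma>, M\<^sub>S)) T \<tau>"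
    for T :: "'t esp" and \<tau> :: "'t \<Rightarrow> 'a + 'n + unit"
  proof
    assume "may_pass (S, \<sigma>, M\<^sub>S) T \<tau>"
    then show "may_pass (rigid_image (S, \<sigma>, M\<^sub>S)) T \<tau>"
      using rigid_fun_confs[OF S \<sigma>] pairing_defined_rigid[OF st] by simp blast
  next
    assume "may_pass (rigid_image (S, \<sigma>, M\<^sub>S)) T \<tau>"
    then obtain z y where z: "z \<in> confs (rigid_es S \<sigma>)"
      and y: "y \<in> confs (visible T)" "Inr () \<in> visible_map \<tau> ` y"
      and zy: "pairing_defined (rigid_es S \<sigma>) (rigid_map S \<sigma>) z (visible T) (visible_map \<tau>) y"
      by auto
    \<comment> \<open>Reflexivity is inherited from \<open>S\<close> through rigidity, which avoids
      proving all event structure axioms for the rigid image.\<close>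
    have refl: "(p, p) \<in> leq (rigid_es S \<sigma>)" if "p \<in> z" for p
    proof -
      have "p \<in> rigid_fun S \<sigma> ` events S"
        using confsD(1)[OF z] that by (auto simp: rigid_es_def)
      then obtain s where "s \<in> events S" "p = rigid_fun S \<sigma> s" by blast
      then show ?thesis
        using leq_rigid_es_iff[OF S \<sigma>, of s p] event_structure_leq(4)[OF S] by blast
    qed
    \<comment> \<open>\<open>z\<close> may be infinite and without a preimage configuration, so the
      pairing is cut down before lifting.\<close>
    obtain z' y' where z': "z' \<in> confs (rigid_es S \<sigma>)" "finite z'"
        and y': "y' \<in> confs (visible T)" "Inr () \<in> visible_map \<tau> ` y'"
        and d: "pairing_defined (rigid_es S \<sigma>) (rigid_map S \<sigma>) z' (visible T) (visible_map \<tau>) y'"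
      by (rule pairing_defined_finite[OF z y(1) refl zy y(2)])
    obtain x where x: "x \<in> confs S" "rigid_fun S \<sigma> ` x = z'"
      using finite_rigid_conf_lift[OF S \<sigma> z'] .
    then have "pairing_defined S \<sigma> x (visible T) (visible_map \<tau>) y'"
      using pairing_defined_rigid[OF st x(1)] d by blast
    then show "may_pass (S, \<sigma>, M\<^sub>S) T \<tau>"
      unfolding may_pass.simps using x(1) y' by blast
  qed
  moreover have "must_pass (S, \<sigma>, M\<^sub>S) T \<tau> \<longleftrightarrow> must_pass (rigid_image (S, \<sigma>, M\<^sub>S)) T \<tau>"
    for T :: "'t esp" and \<tau> :: "'t \<Rightarrow> 'a + 'n + unit"
  proof -
    \<comment> \<open>The stopping configurations of the rigid image are by definition the images of
      those in \<open>M\<^sub>S\<close>, so both must conditions range over the same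
      \<open>x\<close> and \<open>y\<close>.\<close>
    have "pairing_defined (rigid_es S \<sigma>) (rigid_map S \<sigma>) (rigid_fun S \<sigma> ` x)
        (visible T) (visible_map \<tau>) y \<longleftrightarrow>
      pairing_defined S \<sigma> x (visible T) (visible_map \<tau>) y" if "x \<in> M\<^sub>S" for x y
      using pairing_defined_rigid[OF st] M that by blast
    then show ?thesis by simp
  qed
  ultimately show ?thesis unfolding may_equivalent_def must_equivalent_def by blast
qed

end
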